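(* Let $m, n \geq 1$ be integers. For any real $n \times m$ matrix $A \in \mathrm{Mat}_{n \times m}(\mathbb{R})$, $$\dim \mathbf{Bad}_A = n .$$
   Context: $\dim$ denotes Hausdorff dimension. For a vector $\mathbf{v} \in \mathbb{R}^k$, $|\mathbf{v}|$ denotes the maximum of the absolute values of its coordinates (the infinity norm), and $\|\mathbf{v}\| := \min_{\mathbf{y} \in \mathbb{Z}^k} |\mathbf{v} - \mathbf{y}|$ is the distance to the nearest integer vector in this norm. For an $n \times m$ real matrix $A$, the set $\mathbf{Bad}_A$ is defined by $$\mathbf{Bad}_A := \left\{ \mathbf{x} \in [0,1)^n : \exists\, c(\mathbf{x}) > 0 \text{ such that } \|A\mathbf{q} - \mathbf{x}\| \geq \frac{c(\mathbf{x})}{|\mathbf{q}|^{m/n}} \ \text{ for all } \mathbf{q} \in \mathbb{Z}^m \setminus \{\mathbf{0}\} \right\}.$$ *)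

theory Defs
  imports "HOL-Analysis.Analysis"
begin

text \<open>
  The cost of a covering set is its diameter to the power \<open>s\<close>. As \<open>0 powr 0 = 0\<close> in Isabelle, the
  case \<open>s = 0\<close> is separate, so that the 0-dimensional measure is the counting measure.
\<close>

definition hausdorff_gauge :: "real \<Rightarrow> 'a::metric_space set \<Rightarrow> ennreal" where
  "hausdorff_gauge s U =
     (if U = {} then 0 else if s = 0 then 1 else ennreal (diameter U powr s))"

text \<open>Boundedness is required explicitly because \<open>diameter\<close> is unspecified on unbounded sets.\<close>

definition hausdorff_premeasure :: "real \<Rightarrow> real \<Rightarrow> 'a::metric_space set \<Rightarrow> ennreal" where
  "hausdorff_premeasure s \<delta> S =
     (INF U \<in> {U :: nat \<Rightarrow> 'a set.
                 S \<subseteq> (\<Union>i. U i) \<and> (\<forall>i. bounded (U i) \<and> diameter (U i) \<le> \<delta>)}.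
        \<Sum>i. hausdorff_gauge s (U i))"

definition hausdorff_measure :: "real \<Rightarrow> 'a::metric_space set \<Rightarrow> ennreal" where
  "hausdorff_measure s S = (SUP \<delta> \<in> {0<..}. hausdorff_premeasure s \<delta> S)"

text \<open>
  On \<open>real ^ 'n\<close> diameters are Euclidean; the maximum norm gives the same dimension, as the two
  metrics are bi-Lipschitz equivalent.
\<close>

definition hausdorff_dim :: "'a::metric_space set \<Rightarrow> ennreal" where
  "hausdorff_dim S = (INF s \<in> {s. 0 \<le> s \<and> hausdorff_measure s S = 0}. ennreal s)"

definition int_vectors :: "(real ^ 'k) set" where
  "int_vectors = {y. \<forall>i. y $ i \<in> \<int>}"

definition dist_int :: "real ^ 'k \<Rightarrow> real" where
  "dist_int v = (INF y \<in> int_vectors. infnorm (v - y))"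

text \<open>The infimum is attained, so it is the usual minimum over integer vectors.\<close>

lemma dist_int_attained:
  "\<exists>y \<in> int_vectors. dist_int v = infnorm (v - y) \<and>
     (\<forall>z \<in> int_vectors. infnorm (v - y) \<le> infnorm (v - z))"
proof -
  define y where "y = (\<chi> i. real_of_int (round (v $ i)))"
  have y: "y \<in> int_vectors"
    by (simp add: y_def int_vectors_def)
  have le: "infnorm (v - y) \<le> infnorm (v - z)" if "z \<in> int_vectors" for z
  proof -
    have "\<bar>(v - y) $ i\<bar> \<le> infnorm (v - z)" for i
    proof -
      obtain k where k: "z $ i = of_int k"
        using \<open>z \<in> int_vectors\<close> by (auto simp: int_vectors_def elim: Ints_cases)
      have "\<bar>(v - y) $ i\<bar> \<le> \<bar>(v - z) $ i\<bar>"
        using round_diff_minimal[of "v $ i" k] by (simp add: y_def k)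
      also have "\<dots> \<le> infnorm (v - z)"
        by (rule component_le_infnorm_cart)
      finally show ?thesis .
    qed
    then show ?thesis
      unfolding infnorm_cart[of "v - y"] by (intro cSup_least) auto
  qed
  have "dist_int v = infnorm (v - y)"
    unfolding dist_int_def by (rule cInf_eq_minimum) (use y le in auto)
  with y le show ?thesis by blast
qed

definition Bad :: "real ^ 'm ^ 'n \<Rightarrow> (real ^ 'n) set" where
  "Bad A = {x. (\<forall>i. 0 \<le> x $ i \<and> x $ i < 1) \<and>
     (\<exists>c > 0. \<forall>q \<in> int_vectors - {0}.
        dist_int (A *v q - x) \<ge> c / infnorm q powr (real CARD('m) / real CARD('n)))}"

end

theory Submission
  imports Defs
begin

text \<open>
  Write \<open>m = CARD('m)\<close>, \<open>n = CARD('n)\<close> and \<open>|v|\<close> for the maximum norm. Since \<open>Bad A\<close> lies in the unit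
  cube, its dimension is at most \<open>n\<close>; the content is the lower bound. The points \<open>A *v q\<close> may cluster
  badly modulo 1 (think of a rational \<open>A\<close>), so deleting small balls around them is not a uniform
  construction. The way around this is duality: clustering is caused by integer vectors \<open>y\<close> for which
  \<open>y v* A\<close> is nearly integral, and the part of the torus that the points neglect or crowd is described
  by the linear forms \<open>x \<mapsto> y \<bullet> x\<close>.

  For each \<open>j\<close> let \<open>y\<^sub>j\<close> be a shortest nonzero integer vector such that \<open>y\<^sub>j v* A\<close> is within \<open>2\<^sup>-\<^sup>j\<close> of an
  integer vector. Dirichlet's pigeonhole argument gives \<open>|y\<^sub>j| \<le> 2 powr (j m / n)\<close>. Let \<open>x\<close> be a
  point such that every \<open>y\<^sub>j \<bullet> x\<close> has distance at least \<open>c\<close> from the integers. For integer vectors \<open>q\<close>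
  and \<open>w\<close>, the number \<open>y\<^sub>j \<bullet> x\<close> is congruent modulo 1 to \<open>(y\<^sub>j v* A) \<bullet> q - y\<^sub>j \<bullet> (A *v q - x - w)\<close>.
  Choosing \<open>2\<^sup>j\<close> of the order of \<open>|q|\<close> brings the first term within \<open>c / 2\<close> of an integer, so that \<open>A *v q - x\<close> has distance at least of the order of
  \<open>1 / |y\<^sub>j|\<close>, hence of \<open>|q| powr (- m / n)\<close>, from the integer vectors: \<open>x \<in> Bad A\<close>
  (\<open>Bad_if_bad_for_dual_approx\<close>).

  It remains to see that such \<open>x\<close> abound. The vectors \<open>y\<^sub>j\<close> are lacunary: at most \<open>4 ^ n + 1\<close> of
  them have their norm in \<open>{R..<2 * R}\<close>, because the difference of two of them that are close to each other
  would be a shorter candidate at an earlier stage (\<open>card_shortest_dual_approx_dyadic\<close>). Subdivide cubes repeatedly into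
  \<open>L ^ n\<close> subcubes, and treat \<open>y\<^sub>j\<close> at the scale at which \<open>y\<^sub>j \<bullet> x\<close> varies by less than 1 over a cube.
  Only one of the slabs where \<open>y\<^sub>j \<bullet> x\<close> is almost an integer then matters, and it meets at most a constant
  times \<open>L ^ (n - 1)\<close> subcubes (\<open>card_cubes_meeting_slab\<close>). At most a constant times \<open>log L\<close> of the
  vectors are treated at one scale, so for large \<open>L\<close> at least half of the subcubes survive.

  Such a construction reaches every dimension below \<open>n\<close>. If \<open>t < n\<close> and sets \<open>U i\<close> of small total
  \<open>t\<close>-dimensional cost were a cover of \<open>Bad A\<close>, one could descend through surviving subcubes while
  keeping the cost of the sets that meet the current cube of side \<open>h\<close> below a fixed multiple of
  \<open>h powr t\<close>: averaging over the at least \<open>L ^ n / 2\<close> surviving subcubes does better than the factor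
  \<open>L powr (- t)\<close> that is needed. The limit point lies in \<open>Bad A\<close> and in no \<open>U i\<close>
  (\<open>ex_point_avoiding_small_cover\<close>). No measure on the set of limit points has to be constructed.
\<close>

section \<open>Integer vectors and the maximum norm\<close>

lemma infnorm_le_iff_cart: "infnorm (v::real^'k) \<le> d \<longleftrightarrow> (\<forall>i. \<bar>v $ i\<bar> \<le> d)"
proof
  assume "\<forall>i. \<bar>v $ i\<bar> \<le> d"
  then show "infnorm v \<le> d"
    unfolding infnorm_cart by (intro cSup_least) auto
qed (meson component_le_infnorm_cart order_trans)

lemma infnorm_attained_cart:
  fixes v :: "real^'k"
  obtains i where "\<bar>v $ i\<bar> = infnorm v"
proof -
  have "\<exists>i. infnorm v \<le> \<bar>v $ i\<bar>"
  proof -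
    define M where "M = Max (range (\<lambda>i. \<bar>v $ i\<bar>))"
    have "M \<in> range (\<lambda>i. \<bar>v $ i\<bar>)"
      unfolding M_def by (rule Max_in) auto
    moreover have "infnorm v \<le> M"
      unfolding infnorm_le_iff_cart M_def by auto
    ultimately show ?thesis by auto
  qed
  then show thesis
    using that component_le_infnorm_cart[of v] by (meson order_antisym)
qed

lemma abs_inner_le_infnorm:
  fixes x y :: "real^'k"
  shows "\<bar>x \<bullet> y\<bar> \<le> real CARD('k) * infnorm x * infnorm y"
proof -
  have "\<bar>x \<bullet> y\<bar> \<le> (\<Sum>i\<in>UNIV. \<bar>x $ i * y $ i\<bar>)"
    unfolding inner_vec_def inner_real_def by (rule sum_abs)
  also have "\<dots> \<le> (\<Sum>i\<in>(UNIV::'k set). infnorm x * infnorm y)"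
    unfolding abs_mult
    by (intro sum_mono mult_mono component_le_infnorm_cart infnorm_pos_le) auto
  finally show ?thesis by simp
qed

lemma int_vectors_diff: "x \<in> int_vectors \<Longrightarrow> y \<in> int_vectors \<Longrightarrow> x - y \<in> int_vectors"
  by (simp add: int_vectors_def)

lemma inner_int_vectors: "x \<in> int_vectors \<Longrightarrow> y \<in> int_vectors \<Longrightarrow> x \<bullet> y \<in> \<int>"
  by (auto simp: int_vectors_def inner_vec_def intro!: Ints_sum Ints_mult)

lemma infnorm_int_vectors_ge_1:
  assumes "y \<in> int_vectors" "y \<noteq> 0"
  shows "1 \<le> infnorm (y :: real^'k)"
proof -
  obtain i where "y $ i \<noteq> 0" using assms(2) by (auto simp: vec_eq_iff)
  then have "1 \<le> \<bar>y $ i\<bar>"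
    using assms(1) by (auto simp: int_vectors_def intro: Ints_nonzero_abs_ge1)
  then show ?thesis using component_le_infnorm_cart[of y i] by linarith
qed

lemma vector_matrix_mult_diff_distrib: "(x - y) v* A = x v* A - y v* (A :: real^'m^'n)"
  by (metis matrix_vector_mult_diff_distrib transpose_matrix_vector)

lemma dist_int_le: "z \<in> int_vectors \<Longrightarrow> dist_int v \<le> infnorm (v - z)"
  using dist_int_attained[of v] by metis

lemma dist_int_diff_le: "dist_int (u - v) \<le> dist_int u + dist_int v"
proof -
  obtain y where y: "y \<in> int_vectors" "dist_int u = infnorm (u - y)"
    using dist_int_attained by blast
  obtain z where z: "z \<in> int_vectors" "dist_int v = infnorm (v - z)"
    using dist_int_attained by blast
  have "dist_int (u - v) \<le> infnorm ((u - v) - (y - z))"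
    by (intro dist_int_le int_vectors_diff y z)
  also have "(u - v) - (y - z) = (u - y) + - (v - z)" by simp
  also have "infnorm \<dots> \<le> infnorm (u - y) + infnorm (v - z)"
    using infnorm_triangle[of "u - y" "- (v - z)"] by (simp only: infnorm_neg)
  finally show ?thesis using y z by simp
qed

lemma same_floor_imp_close: "\<lfloor>a\<rfloor> = \<lfloor>b\<rfloor> \<Longrightarrow> \<bar>a - b\<bar> < (1::real)"
  by linarith

lemma dist_int_diff_le_of_same_box:
  fixes u v :: "real^'k"
  assumes "0 < K" and box: "\<And>l. \<lfloor>real K * frac (u $ l)\<rfloor> = \<lfloor>real K * frac (v $ l)\<rfloor>"
  shows "dist_int (u - v) \<le> 1 / real K"
proof -
  define z :: "real^'k" where "z = (\<chi> l. of_int \<lfloor>u $ l\<rfloor> - of_int \<lfloor>v $ l\<rfloor>)"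
  have "\<bar>(u - v - z) $ l\<bar> \<le> 1 / real K" for l
  proof -
    have "\<bar>real K * frac (u $ l) - real K * frac (v $ l)\<bar> < 1"
      using box by (rule same_floor_imp_close)
    then have "real K * \<bar>frac (u $ l) - frac (v $ l)\<bar> < 1"
      by (simp add: abs_mult flip: right_diff_distrib)
    moreover have "(u - v - z) $ l = frac (u $ l) - frac (v $ l)"
      by (simp add: z_def frac_def)
    ultimately have "real K * \<bar>(u - v - z) $ l\<bar> \<le> 1" by simp
    then show ?thesis using \<open>0 < K\<close> by (simp only: field_simps)
  qed
  then have "infnorm (u - v - z) \<le> 1 / real K" by (simp add: infnorm_le_iff_cart)
  moreover have "z \<in> int_vectors" by (simp add: int_vectors_def z_def)
  ultimately show ?thesis using dist_int_le[of z "u - v"] by linarith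
qed

section \<open>Integral near-relations between the rows of a matrix\<close>

text \<open>
  More than \<open>K ^ CARD('m)\<close> integer points lie in the cube of side \<open>K powr (CARD('m) / CARD('n))\<close>, while
  the torus splits into \<open>K ^ CARD('m)\<close> boxes of side \<open>1 / K\<close>; two points whose images share a box differ
  by the required vector.
\<close>

lemma Dirichlet_transposed:
  fixes A :: "real^'m^'n"
  assumes "0 < K"
  obtains y where "y \<in> int_vectors" "y \<noteq> 0" "dist_int (y v* A) \<le> 1 / real K"
    "infnorm y \<le> real K powr (real CARD('m) / real CARD('n))"
proof -
  define X where "X = real K powr (real CARD('m) / real CARD('n))"
  define N where "N = nat \<lfloor>X\<rfloor>"
  have "X \<ge> 0" by (simp add: X_def)
  then have N: "real N \<le> X" "X < real (Suc N)" unfolding N_def by linarith+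
  \<comment> \<open>Pigeonhole: the integer points \<open>G\<close> against the boxes \<open>B\<close>, with \<open>(N + 1) ^ CARD('n) > K ^ CARD('m)\<close>.\<close>
  define G :: "('n \<Rightarrow> nat) set" where "G = (\<Pi>\<^sub>E i\<in>UNIV. {..N})"
  define B :: "('m \<Rightarrow> int) set" where "B = (\<Pi>\<^sub>E l\<in>UNIV. {0..<int K})"
  define V :: "('n \<Rightarrow> nat) \<Rightarrow> real^'n" where "V g = (\<chi> i. real (g i))" for g
  define box where "box g = (\<lambda>l. \<lfloor>real K * frac ((V g v* A) $ l)\<rfloor>)" for g
  have "box ` G \<subseteq> B"
  proof -
    have "real K * frac t < real K" for t using assms by (simp add: frac_lt_1)
    then show ?thesis by (auto simp: box_def B_def floor_less_iff)
  qed
  moreover have fin: "finite B" unfolding B_def by (intro finite_PiE) auto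
  ultimately have "card (box ` G) \<le> card B" by (simp add: card_mono)
  also have "card B = K ^ CARD('m)" by (simp add: B_def card_PiE)
  also have "\<dots> < card G"
  proof -
    have "real (K ^ CARD('m)) = X ^ CARD('n)"
      using assms by (simp add: X_def powr_powr flip: powr_realpow powr_numeral)
    also have "\<dots> < real (Suc N) ^ CARD('n)"
      using N \<open>X \<ge> 0\<close> by (intro power_strict_mono) auto
    also have "\<dots> = real (card G)" by (simp add: G_def card_PiE)
    finally show ?thesis by linarith
  qed
  finally have "\<not> inj_on box G" by (rule pigeonhole)
  then obtain g h where gh: "g \<in> G" "h \<in> G" "g \<noteq> h" "box g = box h"
    by (auto simp: inj_on_def)
  show thesis
  proof
    show "V g - V h \<in> int_vectors" by (simp add: int_vectors_def V_def)
    show "V g - V h \<noteq> 0" using gh(3) by (auto simp: V_def vec_eq_iff fun_eq_iff)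
    have "dist_int (V g v* A - V h v* A) \<le> 1 / real K"
      using gh(4) assms by (intro dist_int_diff_le_of_same_box) (auto simp: box_def fun_eq_iff)
    then show "dist_int ((V g - V h) v* A) \<le> 1 / real K"
      by (simp add: vector_matrix_mult_diff_distrib)
    have "\<bar>real (g i) - real (h i)\<bar> \<le> X" for i
    proof -
      have "g i \<le> N" "h i \<le> N" using gh(1,2) by (auto simp: G_def PiE_iff)
      then show ?thesis using N by linarith
    qed
    then show "infnorm (V g - V h) \<le> real K powr (real CARD('m) / real CARD('n))"
      unfolding infnorm_le_iff_cart X_def[symmetric] by (simp add: V_def)
  qed
qed

definition dual_approx :: "real^'m^'n \<Rightarrow> nat \<Rightarrow> (real^'n) set" where
  "dual_approx A j = {y \<in> int_vectors. y \<noteq> 0 \<and> dist_int (y v* A) \<le> (1/2) ^ j}"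

lemma finite_int_vectors_infnorm_le: "finite {y \<in> int_vectors. infnorm (y::real^'k) \<le> R}"
proof -
  define V :: "('k \<Rightarrow> int) \<Rightarrow> real^'k" where "V g = (\<chi> i. of_int (g i))" for g
  have "{y \<in> int_vectors. infnorm y \<le> R} \<subseteq> V ` (\<Pi>\<^sub>E i\<in>UNIV. {-\<lceil>R\<rceil>..\<lceil>R\<rceil>})"
  proof
    fix y :: "real^'k" assume y: "y \<in> {y \<in> int_vectors. infnorm y \<le> R}"
    have "\<bar>y $ i\<bar> \<le> R" for i
      using y by (simp add: infnorm_le_iff_cart)
    then have "- of_int \<lceil>R\<rceil> \<le> y $ i \<and> y $ i \<le> of_int \<lceil>R\<rceil>" for i
      using le_of_int_ceiling[of R] by (smt (verit))
    then have "\<lfloor>y $ i\<rfloor> \<in> {-\<lceil>R\<rceil>..\<lceil>R\<rceil>}" for i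
      by (simp add: le_floor_iff floor_le_iff) (smt (verit))
    moreover have "y = V (\<lambda>i. \<lfloor>y $ i\<rfloor>)"
    proof -
      have "y $ i = of_int \<lfloor>y $ i\<rfloor>" for i
        using y by (simp add: int_vectors_def)
      then show ?thesis by (simp add: V_def vec_eq_iff)
    qed
    ultimately show "y \<in> V ` (\<Pi>\<^sub>E i\<in>UNIV. {-\<lceil>R\<rceil>..\<lceil>R\<rceil>})"
      by (intro image_eqI) auto
  qed
  then show ?thesis by (rule finite_subset) (intro finite_imageI finite_PiE, auto)
qed

lemma ex_shortest_dual_approx:
  fixes A :: "real^'m^'n"
  shows "\<exists>y \<in> dual_approx A j. \<forall>z \<in> dual_approx A j. infnorm y \<le> infnorm z"
proof -
  obtain y0 where y0: "y0 \<in> dual_approx A j"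
    using Dirichlet_transposed[of "2^j" A] by (auto simp: dual_approx_def power_one_over)
  define F where "F = {y \<in> dual_approx A j. infnorm y \<le> infnorm y0}"
  have "F \<subseteq> {y \<in> int_vectors. infnorm y \<le> infnorm y0}"
    by (auto simp: F_def dual_approx_def)
  then have F: "finite F" "y0 \<in> F"
    using finite_int_vectors_infnorm_le finite_subset y0 by (blast, simp add: F_def)
  obtain y where "y \<in> F" "\<forall>z\<in>F. infnorm y \<le> infnorm z"
    using F by (metis arg_min_if_finite(1) arg_min_least empty_iff)
  then show ?thesis using F(2) by (auto simp: F_def) (meson linear order_trans)
qed

text \<open>
  Minimality is what makes this sequence lacunary; an arbitrary sequence of vectors supplied by
  \<open>Dirichlet_transposed\<close> need not be.
\<close>

definition shortest_dual_approx :: "real^'m^'n \<Rightarrow> nat \<Rightarrow> real^'n" where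
  "shortest_dual_approx A j =
     (SOME y. y \<in> dual_approx A j \<and> (\<forall>z \<in> dual_approx A j. infnorm y \<le> infnorm z))"

lemma shortest_dual_approx:
  "shortest_dual_approx A j \<in> dual_approx A j"
  "z \<in> dual_approx A j \<Longrightarrow> infnorm (shortest_dual_approx A j) \<le> infnorm z"
  unfolding shortest_dual_approx_def
  using someI_ex[OF ex_shortest_dual_approx[of A j, unfolded Bex_def]] by blast+

lemma infnorm_shortest_dual_approx:
  fixes A :: "real^'m^'n"
  shows "infnorm (shortest_dual_approx A j) \<le> (2^j) powr (real CARD('m) / real CARD('n))"
proof -
  obtain y where "y \<in> dual_approx A j" "infnorm y \<le> (2^j) powr (real CARD('m) / real CARD('n))"
    using Dirichlet_transposed[of "2^j" A] by (auto simp: dual_approx_def power_one_over)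
  then show ?thesis using shortest_dual_approx(2) by force
qed

text \<open>
  Let \<open>j0\<close> be the first index whose vector has its norm in the range. Two distinct later vectors are
  both twice as good as required at stage \<open>j0\<close>, so their difference is a candidate at that stage and
  has norm at least \<open>R\<close>. They therefore lie in different boxes of side \<open>R\<close>, and \<open>4 ^ CARD('n)\<close> boxes
  suffice to hold all of them.
\<close>

lemma card_shortest_dual_approx_dyadic:
  fixes A :: "real^'m^'n"
  assumes "0 < R"
  defines "Y \<equiv> {y \<in> range (shortest_dual_approx A). R \<le> infnorm y \<and> infnorm y < 2 * R}"
  shows "finite Y" "card Y \<le> 4 ^ CARD('n) + 1"
proof -
  have "Y \<subseteq> {y \<in> int_vectors. infnorm y \<le> 2 * R}"
    using shortest_dual_approx(1) by (fastforce simp: Y_def dual_approx_def)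
  then show fin: "finite Y" using finite_int_vectors_infnorm_le finite_subset by blast
  show "card Y \<le> 4 ^ CARD('n) + 1"
  proof (cases "Y = {}")
    case False
    define J where "J = {j. shortest_dual_approx A j \<in> Y}"
    define j0 where "j0 = (LEAST j. j \<in> J)"
    obtain j1 where "j1 \<in> J" using False by (auto simp: J_def Y_def)
    then have j0: "j0 \<in> J" "\<And>j. j \<in> J \<Longrightarrow> j0 \<le> j"
      unfolding j0_def by (auto intro: LeastI[of "\<lambda>j. j \<in> J"] Least_le)
    define y0 where "y0 = shortest_dual_approx A j0"
    define box where "box y = (\<lambda>i. \<lfloor>y $ i / R\<rfloor>)" for y :: "real^'n"
    have later: "y \<in> int_vectors \<and> dist_int (y v* A) \<le> (1/2) ^ j0 / 2" if y: "y \<in> Y - {y0}" for y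
    proof -
      obtain j where j: "y = shortest_dual_approx A j" "j \<in> J"
        using y by (auto simp: J_def Y_def)
      then have "Suc j0 \<le> j"
        using j0(2)[OF j(2)] y by (cases "j = j0") (auto simp: y0_def)
      then have "(1/2) ^ j \<le> (1/2 :: real) ^ Suc j0" by (rule power_decreasing) auto
      then show ?thesis using shortest_dual_approx(1)[of A j] j(1) by (auto simp: dual_approx_def)
    qed
    have "inj_on box (Y - {y0})"
    proof (rule inj_onI, rule ccontr)
      fix y z assume yz: "y \<in> Y - {y0}" "z \<in> Y - {y0}" "box y = box z" "y \<noteq> z"
      have "dist_int ((y - z) v* A) \<le> (1/2) ^ j0"
        using dist_int_diff_le[of "y v* A" "z v* A"] later[OF yz(1)] later[OF yz(2)]
        by (simp add: vector_matrix_mult_diff_distrib)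
      then have "y - z \<in> dual_approx A j0"
        using later[OF yz(1)] later[OF yz(2)] yz(4) int_vectors_diff[of y z]
        by (simp add: dual_approx_def)
      then have "infnorm y0 \<le> infnorm (y - z)"
        unfolding y0_def by (rule shortest_dual_approx(2))
      moreover have "R \<le> infnorm y0" using j0(1) by (simp add: J_def Y_def y0_def)
      moreover obtain i where "\<bar>(y - z) $ i\<bar> = infnorm (y - z)"
        by (rule infnorm_attained_cart)
      moreover have "\<bar>(y - z) $ i\<bar> < R"
      proof -
        have "\<bar>y $ i / R - z $ i / R\<bar> < 1"
          using yz(3) by (intro same_floor_imp_close) (simp add: box_def fun_eq_iff)
        then show ?thesis using \<open>0 < R\<close> by (simp flip: diff_divide_distrib)
      qed
      ultimately show False by linarith
    qed
    moreover have "box ` (Y - {y0}) \<subseteq> (\<Pi>\<^sub>E i\<in>UNIV. {-2..1})"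
    proof -
      have "\<lfloor>y $ i / R\<rfloor> \<in> {-2..1}" if "y \<in> Y" for y i
      proof -
        have "\<bar>y $ i\<bar> < 2 * R" using that component_le_infnorm_cart[of y i] by (simp add: Y_def)
        then have "- 2 \<le> y $ i / R" "y $ i / R < 2"
          using \<open>0 < R\<close> by (auto simp: field_simps abs_less_iff)
        then show ?thesis by (simp add: le_floor_iff floor_le_iff)
      qed
      then show ?thesis by (auto simp: box_def)
    qed
    moreover have "finite (\<Pi>\<^sub>E i\<in>(UNIV::'n set). {-2..1::int})" by (intro finite_PiE) auto
    ultimately have "card (Y - {y0}) \<le> card (\<Pi>\<^sub>E i\<in>(UNIV::'n set). {-2..1::int})"
      by (rule card_inj_on_le)
    also have "\<dots> = 4 ^ CARD('n)" by (simp add: card_PiE)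
    finally show ?thesis using diff_card_le_card_Diff[of "{y0}" Y] by simp
  qed simp
qed

section \<open>Transference from the dual approximations\<close>

text \<open>
  For an integer vector \<open>q\<close>, the number \<open>y \<bullet> x\<close> differs from an integer by
  \<open>(y v* A - z) \<bullet> q - y \<bullet> (A *v q - x - w)\<close> with \<open>z\<close> and \<open>w\<close> the nearest integer vectors. If \<open>y v* A\<close> is so
  close to \<open>z\<close> that the first term is at most \<open>c / 2\<close>, the second one is at least \<open>c / 2\<close>, which
  keeps \<open>A *v q - x\<close> away from \<open>w\<close>.
\<close>

lemma Bad_if_bad_for_dual_approx:
  fixes A :: "real^'m^'n"
  assumes unit: "\<And>i. 0 \<le> x $ i \<and> x $ i < 1"
    and "0 < c"
    and far: "\<And>j p. p \<in> \<int> \<Longrightarrow> c \<le> \<bar>shortest_dual_approx A j \<bullet> x - p\<bar>"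
  shows "x \<in> Bad A"
proof -
  define m where "m = real CARD('m)"
  define n where "n = real CARD('n)"
  have mn: "1 \<le> m" "1 \<le> n" by (simp_all add: m_def n_def Suc_leI)
  have "c \<le> 1"
  proof -
    define t where "t = shortest_dual_approx A 0 \<bullet> x"
    have "c \<le> \<bar>t - of_int \<lfloor>t\<rfloor>\<bar>" unfolding t_def by (rule far) simp
    then show ?thesis by linarith
  qed
  define c' where "c' = c / (2 * n) / (4 * m / c) powr (m / n)"
  have "c' > 0" using mn \<open>0 < c\<close> by (simp add: c'_def)
  moreover have "c' / infnorm q powr (m / n) \<le> dist_int (A *v q - x)"
    if q: "q \<in> int_vectors - {0}" for q
  proof -
    have q1: "1 \<le> infnorm q" using q infnorm_int_vectors_ge_1 by auto
    \<comment> \<open>The stage \<open>j\<close> is the first with \<open>m * (1/2) ^ j * |q| \<le> c / 2\<close>; being first bounds \<open>|y|\<close> in terms of \<open>|q|\<close>.\<close>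
    define T where "T = 2 * m * infnorm q / c"
    have "1 * 1 \<le> m * infnorm q" using q1 mn by (intro mult_mono) auto
    then have "c \<le> 2 * m * infnorm q" using \<open>c \<le> 1\<close> by simp
    then have T1: "1 \<le> T" using \<open>0 < c\<close> by (simp add: T_def)
    have "\<exists>j. T \<le> 2 ^ j"
      using real_arch_pow[of 2 T] by (auto intro: less_imp_le)
    define j where "j = (LEAST j. T \<le> 2 ^ j)"
    have j: "T \<le> 2 ^ j" unfolding j_def using \<open>\<exists>j. T \<le> 2 ^ j\<close> by (rule LeastI_ex)
    have j': "2 ^ j \<le> 2 * T"
    proof (cases j)
      case (Suc i)
      then have "\<not> T \<le> 2 ^ i" unfolding j_def by (metis lessI not_less_Least)
      then show ?thesis using Suc by simp
    qed (use T1 in simp)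
    define y where "y = shortest_dual_approx A j"
    have y: "y \<in> int_vectors" "y \<noteq> 0" "dist_int (y v* A) \<le> (1/2) ^ j"
      using shortest_dual_approx(1)[of A j] by (auto simp: y_def dual_approx_def)
    have y1: "1 \<le> infnorm y" using y infnorm_int_vectors_ge_1 by auto
    obtain z where z: "z \<in> int_vectors" "dist_int (y v* A) = infnorm (y v* A - z)"
      using dist_int_attained by blast
    obtain w where w: "w \<in> int_vectors" "dist_int (A *v q - x) = infnorm (A *v q - x - w)"
      using dist_int_attained by blast
    have "z \<bullet> q - y \<bullet> w \<in> \<int>" using inner_int_vectors[of z q] inner_int_vectors[of y w] y z w q by auto
    then have "c \<le> \<bar>y \<bullet> x - (z \<bullet> q - y \<bullet> w)\<bar>" unfolding y_def by (rule far)
    also have "y \<bullet> x - (z \<bullet> q - y \<bullet> w) = (y v* A - z) \<bullet> q - y \<bullet> (A *v q - x - w)"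
      by (simp add: inner_diff_left inner_diff_right dot_lmul_matrix)
    also have "\<bar>\<dots>\<bar> \<le> \<bar>(y v* A - z) \<bullet> q\<bar> + \<bar>y \<bullet> (A *v q - x - w)\<bar>"
      by (rule abs_triangle_ineq4)
    also have "\<dots> \<le> m * (1/2) ^ j * infnorm q + n * infnorm y * dist_int (A *v q - x)"
    proof (rule add_mono)
      have "\<bar>(y v* A - z) \<bullet> q\<bar> \<le> m * infnorm (y v* A - z) * infnorm q"
        unfolding m_def by (rule abs_inner_le_infnorm)
      also have "\<dots> \<le> m * (1/2) ^ j * infnorm q"
        using y(3) z(2) mn by (intro mult_right_mono mult_left_mono infnorm_pos_le) auto
      finally show "\<bar>(y v* A - z) \<bullet> q\<bar> \<le> m * (1/2) ^ j * infnorm q" .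
      show "\<bar>y \<bullet> (A *v q - x - w)\<bar> \<le> n * infnorm y * dist_int (A *v q - x)"
        unfolding n_def w(2) by (rule abs_inner_le_infnorm)
    qed
    also have "m * (1/2) ^ j * infnorm q \<le> c / 2"
      using j \<open>0 < c\<close> by (simp add: T_def field_simps power_one_over)
    finally have "c / 2 \<le> dist_int (A *v q - x) * (n * infnorm y)" by (simp add: mult.commute)
    then have "c / (2 * n) / infnorm y \<le> dist_int (A *v q - x)"
      using mn y1 by (simp add: field_simps)
    moreover have "infnorm y \<le> (4 * m / c) powr (m / n) * infnorm q powr (m / n)"
    proof -
      have "infnorm y \<le> (2 ^ j) powr (m / n)"
        unfolding y_def m_def n_def by (rule infnorm_shortest_dual_approx)
      also have "\<dots> \<le> (2 * T) powr (m / n)" using j' mn by (intro powr_mono2) auto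
      also have "2 * T = (4 * m / c) * infnorm q" by (simp add: T_def)
      also have "\<dots> powr (m / n) = (4 * m / c) powr (m / n) * infnorm q powr (m / n)" by (rule powr_mult)
      finally show ?thesis .
    qed
    then have "c / (2 * n) / ((4 * m / c) powr (m / n) * infnorm q powr (m / n)) \<le> c / (2 * n) / infnorm y"
      using y1 mn \<open>0 < c\<close> by (intro divide_left_mono) auto
    ultimately show ?thesis by (simp add: c'_def)
  qed
  ultimately show ?thesis
    using unit unfolding Bad_def m_def n_def by blast
qed

section \<open>Subdivision of cubes\<close>

definition cube :: "real^'n \<Rightarrow> real \<Rightarrow> (real^'n) set" where
  "cube a h = {x. \<forall>i. a $ i \<le> x $ i \<and> x $ i \<le> a $ i + h}"

text \<open>
  The index \<open>v \<in> grid L\<close> stands for the subcube \<open>cube (corner a (h / L) v) (h / L)\<close> of \<open>cube a h\<close>.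
\<close>

definition grid :: "nat \<Rightarrow> ('n::finite \<Rightarrow> nat) set" where
  "grid L = {v. \<forall>i. v i < L}"

definition corner :: "real^'n \<Rightarrow> real \<Rightarrow> ('n \<Rightarrow> nat) \<Rightarrow> real^'n" where
  "corner a h v = (\<chi> i. a $ i + h * real (v i))"

lemma compact_cube: "compact (cube a h)"
proof -
  have "cube a h = cbox a (\<chi> i. a $ i + h)" by (auto simp: cube_def mem_box_cart)
  then show ?thesis by simp
qed

lemma grid_eq_PiE: "grid L = (\<Pi>\<^sub>E i\<in>UNIV. {..<L})"
  by (auto simp: grid_def)

lemma finite_grid [simp]: "finite (grid L)"
  unfolding grid_eq_PiE by (intro finite_PiE) auto

lemma card_grid: "card (grid L :: ('n::finite \<Rightarrow> nat) set) = L ^ CARD('n)"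
  unfolding grid_eq_PiE by (simp add: card_PiE)

lemma base_mem_cube: "0 \<le> h \<Longrightarrow> a \<in> cube a h"
  by (simp add: cube_def)

lemma cube_corner_subset:
  assumes "v \<in> grid L" "0 \<le> h"
  shows "cube (corner a (h / real L) v) (h / real L) \<subseteq> cube a h"
proof
  fix x assume x: "x \<in> cube (corner a (h / real L) v) (h / real L)"
  show "x \<in> cube a h" unfolding cube_def
  proof (intro CollectI allI)
    fix i
    have "Suc (v i) \<le> L" using assms(1) by (auto simp: grid_def Suc_le_eq)
    then have "real (v i) + 1 \<le> real L" "0 < real L" by linarith+
    then have "h / real L * (real (v i) + 1) \<le> h / real L * real L"
      using assms(2) by (intro mult_left_mono) auto
    then have "h / real L * real (v i) + h / real L \<le> h"
      using \<open>0 < real L\<close> by (simp add: distrib_left)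
    moreover have "0 \<le> h / real L * real (v i)" using assms(2) by simp
    moreover have "a $ i + h / real L * real (v i) \<le> x $ i"
      "x $ i \<le> a $ i + h / real L * real (v i) + h / real L"
      using x by (auto simp: cube_def corner_def)
    ultimately show "a $ i \<le> x $ i \<and> x $ i \<le> a $ i + h" by linarith
  qed
qed

lemma cube_subset_UN_corner:
  assumes "0 < L" "0 < h"
  shows "cube a h \<subseteq> (\<Union>v\<in>grid L. cube (corner a (h / real L) v) (h / real L))"
proof
  fix x assume x: "x \<in> cube a h"
  define t where "t i = real L * (x $ i - a $ i) / h" for i
  define v where "v i = min (L - 1) (nat \<lfloor>t i\<rfloor>)" for i
  have t: "0 \<le> t i" "t i \<le> real L" for i
  proof -
    have xi: "a $ i \<le> x $ i" "x $ i - a $ i \<le> h" using x by (auto simp: cube_def add.commute diff_le_eq)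
    then show "0 \<le> t i" using \<open>0 < h\<close> by (simp add: t_def)
    have "real L * (x $ i - a $ i) \<le> real L * h" using xi(2) by (intro mult_left_mono) auto
    then show "t i \<le> real L" using \<open>0 < h\<close> by (simp add: t_def divide_le_eq)
  qed
  have xt: "x $ i = a $ i + h / real L * t i" for i
    using assms by (simp add: t_def)
  have v: "real (v i) \<le> t i" "t i \<le> real (v i) + 1" for i
    using t[of i] \<open>0 < L\<close> unfolding v_def by (auto simp: min_def of_nat_diff) linarith+
  have "x \<in> cube (corner a (h / real L) v) (h / real L)"
  proof -
    have "h / real L * real (v i) \<le> h / real L * t i" for i
      using v assms by (intro mult_left_mono) auto
    moreover have "h / real L * t i \<le> h / real L * (real (v i) + 1)" for i
      using v assms by (intro mult_left_mono) auto
    ultimately show ?thesis by (auto simp: cube_def corner_def xt distrib_left)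
  qed
  moreover have "v \<in> grid L" using \<open>0 < L\<close> by (auto simp: grid_def v_def)
  ultimately show "x \<in> (\<Union>v\<in>grid L. cube (corner a (h / real L) v) (h / real L))" by blast
qed

lemma infnorm_diff_le_in_cube:
  assumes "x \<in> cube a h" "y \<in> cube a h"
  shows "infnorm (x - y) \<le> h"
proof -
  have "\<bar>(x - y) $ i\<bar> \<le> h" for i
  proof -
    have "a $ i \<le> x $ i \<and> x $ i \<le> a $ i + h" "a $ i \<le> y $ i \<and> y $ i \<le> a $ i + h"
      using assms by (auto simp: cube_def)
    then show ?thesis by (simp add: abs_le_iff)
  qed
  then show ?thesis by (simp add: infnorm_le_iff_cart)
qed

lemma diameter_cube_le:
  assumes "0 \<le> h"
  shows "diameter (cube (a :: real^'n) h) \<le> real CARD('n) * h"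
proof (rule diameter_le)
  show "cube a h \<noteq> {} \<or> 0 \<le> real CARD('n) * h" using assms by simp
  fix x y assume "x \<in> cube a h" "y \<in> cube a h"
  then have *: "infnorm (x - y) \<le> h" by (rule infnorm_diff_le_in_cube)
  have "norm (x - y) \<le> (\<Sum>i\<in>UNIV. \<bar>(x - y) $ i\<bar>)" by (rule norm_le_l1_cart)
  also have "\<dots> \<le> (\<Sum>i\<in>(UNIV::'n set). h)"
    using * unfolding infnorm_le_iff_cart by (intro sum_mono) auto
  finally show "norm (x - y) \<le> real CARD('n) * h" by simp
qed

lemma card_le_if_diffs_bounded:
  fixes S :: "nat set"
  assumes "\<And>a b. a \<in> S \<Longrightarrow> b \<in> S \<Longrightarrow> a \<le> b + d"
  shows "card S \<le> d + 1"
proof (cases "S = {}")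
  case False
  define m where "m = (LEAST a. a \<in> S)"
  have m: "m \<in> S" "\<And>a. a \<in> S \<Longrightarrow> m \<le> a"
    unfolding m_def using False by (auto intro: LeastI Least_le)
  then have "S \<subseteq> {m..m + d}" using assms by auto
  then have "card S \<le> card {m..m + d}" by (intro card_mono) auto
  then show ?thesis by simp
qed simp

section \<open>Subcubes that meet a slab\<close>

text \<open>
  There are \<open>L ^ (CARD('n) - 1)\<close> lines in direction \<open>i\<close>, and each contains at most \<open>d + 1\<close> indices. The factor
  \<open>L\<close> on the left avoids that truncated exponent.
\<close>

lemma card_grid_le_if_lines_le:
  fixes S :: "('n::finite \<Rightarrow> nat) set"
  assumes S: "S \<subseteq> grid L" and "0 < L"
    and line: "\<And>v w. v \<in> S \<Longrightarrow> w \<in> S \<Longrightarrow> (\<And>j. j \<noteq> i \<Longrightarrow> v j = w j) \<Longrightarrow> v i \<le> w i + d"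
  shows "card S * L \<le> (d + 1) * L ^ CARD('n)"
proof -
  define B where "B = (\<Pi>\<^sub>E j\<in>(UNIV::'n set). if j = i then {0} else {..<L})"
  have finB: "finite B" unfolding B_def by (intro finite_PiE) auto
  \<comment> \<open>The lines are indexed by their points \<open>b\<close> with \<open>b i = 0\<close>.\<close>
  define fib where "fib b = {v \<in> S. v(i := 0) = b}" for b
  have fib: "card (fib b) \<le> d + 1" for b
  proof -
    have "inj_on (\<lambda>v. v i) (fib b)"
    proof (rule inj_onI)
      fix v w assume vw: "v \<in> fib b" "w \<in> fib b" "v i = w i"
      then have eq: "v(i := 0) = w(i := 0)" by (simp add: fib_def)
      show "v = w"
      proof
        fix j show "v j = w j" using vw(3) fun_cong[OF eq, of j] by (cases "j = i") auto
      qed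
    qed
    then have "card (fib b) = card ((\<lambda>v. v i) ` fib b)" by (simp add: card_image)
    also have "\<dots> \<le> d + 1"
    proof (rule card_le_if_diffs_bounded)
      fix r s assume "r \<in> (\<lambda>v. v i) ` fib b" "s \<in> (\<lambda>v. v i) ` fib b"
      then obtain v w where vw: "v \<in> S" "w \<in> S" "v(i := 0) = w(i := 0)" "r = v i" "s = w i"
        by (auto simp: fib_def)
      have "v j = w j" if "j \<noteq> i" for j using fun_cong[OF vw(3), of j] that by simp
      then show "r \<le> s + d" using line[OF vw(1,2)] vw(4,5) by simp
    qed
    finally show ?thesis .
  qed
  have "S \<subseteq> (\<Union>b\<in>B. fib b)"
  proof
    fix v assume v: "v \<in> S"
    then have "v(i := 0) \<in> B" using S by (auto simp: B_def grid_def)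
    then show "v \<in> (\<Union>b\<in>B. fib b)" using v by (auto simp: fib_def)
  qed
  moreover have "finite (\<Union>b\<in>B. fib b)"
    using finB finite_subset[OF S finite_grid] by (auto simp: fib_def)
  ultimately have "card S \<le> card (\<Union>b\<in>B. fib b)" by (intro card_mono)
  also have "\<dots> \<le> (\<Sum>b\<in>B. card (fib b))" by (rule card_UN_le[OF finB])
  also have "\<dots> \<le> (\<Sum>b\<in>B. d + 1)" by (intro sum_mono fib)
  finally have "card S \<le> card B * (d + 1)" by simp
  then have "card S * L \<le> card B * (d + 1) * L" by (rule mult_le_mono1)
  also have "\<dots> = (d + 1) * (card B * L)" by (simp only: mult_ac)
  also have "card B * L = L ^ CARD('n)"
  proof -
    have "card B = (\<Prod>j\<in>UNIV. if j = i then 1 else L)"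
      unfolding B_def by (simp add: card_PiE) (rule prod.cong, auto)
    also have "\<dots> = (\<Prod>j\<in>UNIV - {i}. L)"
      by (subst prod.remove[of _ i]) (auto intro!: prod.cong)
    finally have "card B = L ^ (CARD('n) - 1)" by (simp add: card_Diff_singleton)
    then show ?thesis by (simp flip: power_Suc2)
  qed
  finally show ?thesis .
qed

text \<open>
  By \<open>osc\<close>, the form \<open>y \<bullet> x\<close> varies by at most \<open>1/2\<close> over the cube, so near-integral values in it belong
  to a single integer, that is, to one slab. Along the axis of the largest coordinate of \<open>y\<close> consecutive
  subcubes shift the form by \<open>|y| * h / L\<close>, whereas the slab by \<open>thin\<close> and the subcubes themselves
  have a width of only a constant times that amount. Hence each line in this direction has a bounded
  number of subcubes that meet the slab.
\<close>

lemma card_cubes_meeting_slab: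
  fixes y a :: "real^'n"
  defines "n \<equiv> CARD('n)"
  assumes "y \<noteq> 0" "0 < L" "0 < h" "c \<le> 1/4"
    and osc: "2 * real n * infnorm y * h \<le> 1"
    and thin: "2 * c * real L \<le> infnorm y * h"
  defines "S \<equiv> {v \<in> grid L. \<exists>x \<in> cube (corner a (h / real L) v) (h / real L).
                  \<exists>p\<in>\<int>. \<bar>y \<bullet> x - p\<bar> < c}"
  shows "card S * L \<le> (2 * n + 2) * L ^ n"
proof -
  define g where "g = h / real L"
  have g: "0 < g" using assms by (simp add: g_def)
  have y: "0 < infnorm y" using \<open>y \<noteq> 0\<close> by (simp add: infnorm_pos_lt)
  obtain i where i: "\<bar>y $ i\<bar> = infnorm y" by (rule infnorm_attained_cart)
  have "v i \<le> w i + (2 * n + 1)"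
    if vw: "v \<in> S" "w \<in> S" and eq: "\<And>j. j \<noteq> i \<Longrightarrow> v j = w j" for v w
  proof -
    obtain x p where x: "x \<in> cube (corner a g v) g" "p \<in> \<int>" "\<bar>y \<bullet> x - p\<bar> < c"
      using vw(1) unfolding S_def g_def by blast
    obtain x' p' where x': "x' \<in> cube (corner a g w) g" "p' \<in> \<int>" "\<bar>y \<bullet> x' - p'\<bar> < c"
      using vw(2) unfolding S_def g_def by blast
    have "x \<in> cube a h" "x' \<in> cube a h"
      using cube_corner_subset[of v L h a] cube_corner_subset[of w L h a] x(1) x'(1) vw \<open>0 < h\<close>
      by (auto simp: S_def g_def)
    then have "\<bar>y \<bullet> (x - x')\<bar> \<le> 1/2"
    proof -
      have "\<bar>y \<bullet> (x - x')\<bar> \<le> n * infnorm y * infnorm (x - x')"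
        unfolding n_def by (rule abs_inner_le_infnorm)
      also have "\<dots> \<le> n * infnorm y * h"
        using infnorm_diff_le_in_cube[OF \<open>x \<in> cube a h\<close> \<open>x' \<in> cube a h\<close>] y
        by (intro mult_left_mono) auto
      finally show ?thesis using osc by simp
    qed
    then have "\<bar>p - p'\<bar> < 1"
      using x(3) x'(3) \<open>c \<le> 1/4\<close> unfolding inner_diff_right by linarith
    then have "p = p'" using x(2) x'(2)
      by (metis Ints_diff Ints_nonzero_abs_less1 eq_iff_diff_eq_0)
    have lin: "\<bar>y \<bullet> (z - corner a g u)\<bar> \<le> n * infnorm y * g" if "z \<in> cube (corner a g u) g" for z u
    proof -
      have "\<bar>y \<bullet> (z - corner a g u)\<bar> \<le> n * infnorm y * infnorm (z - corner a g u)"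
        unfolding n_def by (rule abs_inner_le_infnorm)
      also have "\<dots> \<le> n * infnorm y * g"
        using infnorm_diff_le_in_cube[OF that base_mem_cube] g y
        by (intro mult_left_mono) auto
      finally show ?thesis .
    qed
    have "corner a g v - corner a g w = (g * (real (v i) - real (w i))) *\<^sub>R axis i 1"
      using eq by (auto simp: vec_eq_iff corner_def axis_def algebra_simps)
    then have "\<bar>y \<bullet> (corner a g v - corner a g w)\<bar> = (infnorm y * g) * \<bar>real (v i) - real (w i)\<bar>"
      using g i by (simp add: inner_axis abs_mult)
    moreover have "\<bar>y \<bullet> (corner a g v - corner a g w)\<bar> \<le> 2 * c + 2 * (n * infnorm y * g)"
      using lin[OF x(1)] lin[OF x'(1)] x(3) x'(3) \<open>p = p'\<close>
      by (simp add: inner_diff_right abs_le_iff abs_less_iff)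
    moreover have "2 * c \<le> infnorm y * g"
      using thin \<open>0 < L\<close> by (simp add: g_def field_simps)
    ultimately have "(infnorm y * g) * \<bar>real (v i) - real (w i)\<bar> \<le> (infnorm y * g) * (2 * real n + 1)"
      by (simp add: algebra_simps)
    then have "\<bar>real (v i) - real (w i)\<bar> \<le> 2 * real n + 1"
      using y g by (simp add: mult_le_cancel_left_pos)
    then show ?thesis by linarith
  qed
  then have line: "v i \<le> w i + (2 * CARD('n) + 1)"
    if "v \<in> S" "w \<in> S" "\<And>j. j \<noteq> i \<Longrightarrow> v j = w j" for v w
    using that unfolding n_def by blast
  have "card S * L \<le> (2 * n + 1 + 1) * L ^ n"
    unfolding n_def
  proof (rule card_grid_le_if_lines_le)
    show "S \<subseteq> grid L" by (auto simp: S_def)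
    show "0 < L" by fact
  qed (rule line)
  then show ?thesis by simp
qed

section \<open>Hausdorff dimension of subsets of the unit cube\<close>

lemma hausdorff_premeasure_le_finite_cover:
  assumes "finite I" "S \<subseteq> (\<Union>i\<in>I. V i)"
    and V: "\<And>i. i \<in> I \<Longrightarrow> bounded (V i) \<and> diameter (V i) \<le> \<delta>" and "0 \<le> \<delta>"
  shows "hausdorff_premeasure s \<delta> S \<le> (\<Sum>i\<in>I. hausdorff_gauge s (V i))"
proof -
  obtain e where e: "bij_betw e {..<card I} I"
    using ex_bij_betw_nat_finite[OF \<open>finite I\<close>] by (auto simp: atLeast0LessThan)
  define U where "U k = (if k < card I then V (e k) else {})" for k
  have "S \<subseteq> (\<Union>k. U k)"
  proof
    fix x assume "x \<in> S"
    then obtain i where "i \<in> I" "x \<in> V i" using assms(2) by auto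
    then obtain k where "k < card I" "e k = i" using e by (metis bij_betw_imp_surj_on imageE lessThan_iff)
    then show "x \<in> (\<Union>k. U k)" using \<open>x \<in> V i\<close> by (auto simp: U_def)
  qed
  moreover have "bounded (U k) \<and> diameter (U k) \<le> \<delta>" for k
    using V[of "e k"] bij_betwE[OF e] \<open>0 \<le> \<delta>\<close> by (auto simp: U_def)
  ultimately have "hausdorff_premeasure s \<delta> S \<le> (\<Sum>k. hausdorff_gauge s (U k))"
    unfolding hausdorff_premeasure_def by (intro INF_lower) auto
  also have "\<dots> = (\<Sum>k<card I. hausdorff_gauge s (U k))"
    by (rule suminf_finite) (auto simp: U_def hausdorff_gauge_def)
  also have "\<dots> = (\<Sum>k<card I. hausdorff_gauge s (V (e k)))"
    by (simp add: U_def)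
  also have "\<dots> = (\<Sum>i\<in>I. hausdorff_gauge s (V i))"
    by (rule sum.reindex_bij_betw[OF e])
  finally show ?thesis .
qed

text \<open>
  Cutting the unit cube into \<open>N ^ n\<close> cubes of diameter at most \<open>n / N\<close> costs at most
  \<open>n powr s * N powr (n - s)\<close>, which tends to 0.
\<close>

lemma hausdorff_measure_eq_0_above_dimension:
  fixes S :: "(real^'n) set"
  assumes S: "S \<subseteq> cube 0 1" and s: "real CARD('n) < s"
  shows "hausdorff_measure s S = 0"
proof -
  define n where "n = real CARD('n)"
  have n: "0 < n" "n < s" using s by (auto simp: n_def)
  have bound: "hausdorff_premeasure s \<delta> S \<le> ennreal (n powr s * real N powr (n - s))"
    if N: "0 < N" "n / real N \<le> \<delta>" for \<delta> N
  proof -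
    define V where "V v = cube (corner (0::real^'n) (1 / real N) v) (1 / real N)" for v
    have diam: "diameter (V v) \<le> n / real N" for v
      using diameter_cube_le[of "1 / real N"] by (simp add: V_def n_def)
    have "S \<subseteq> (\<Union>v\<in>grid N. V v)"
      using S cube_subset_UN_corner[of N 1 0] N(1) by (auto simp: V_def)
    moreover have "bounded (V v)" for v
      unfolding V_def by (rule compact_imp_bounded[OF compact_cube])
    moreover have "diameter (V v) \<le> \<delta>" for v using diam[of v] N(2) by linarith
    moreover have "0 \<le> \<delta>" using N n by (meson divide_nonneg_nonneg less_imp_le of_nat_0_le_iff order_trans)
    ultimately have "hausdorff_premeasure s \<delta> S \<le> (\<Sum>v\<in>grid N. hausdorff_gauge s (V v))"
      by (intro hausdorff_premeasure_le_finite_cover) auto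
    also have "\<dots> \<le> (\<Sum>v\<in>(grid N :: ('n \<Rightarrow> nat) set). ennreal ((n / real N) powr s))"
      using diam n by (intro sum_mono)
        (auto simp: hausdorff_gauge_def V_def diameter_ge_0 compact_imp_bounded compact_cube
              intro!: ennreal_leI powr_mono2)
    also have "\<dots> = of_nat (N ^ CARD('n)) * ennreal ((n / real N) powr s)"
      by (simp add: card_grid)
    also have "\<dots> = ennreal (real (N ^ CARD('n)) * (n / real N) powr s)"
      by (simp only: ennreal_mult' ennreal_of_nat_eq_real_of_nat of_nat_0_le_iff)
    also have "real (N ^ CARD('n)) * (n / real N) powr s = n powr s * real N powr (n - s)"
      using N n by (simp add: powr_divide powr_diff n_def powr_realpow)
    finally show ?thesis .
  qed
  have "hausdorff_premeasure s \<delta> S = 0" if "0 < \<delta>" for \<delta>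
  proof -
    have "(\<lambda>N. real N powr (n - s)) \<longlonglongrightarrow> 0"
      using n by (intro tendsto_neg_powr filterlim_real_sequentially) auto
    then have "(\<lambda>N. n powr s * real N powr (n - s)) \<longlonglongrightarrow> 0"
      by (rule tendsto_mult_right_zero)
    then have "(\<lambda>N. ennreal (n powr s * real N powr (n - s))) \<longlonglongrightarrow> ennreal 0"
      by (intro tendsto_ennrealI)
    moreover have "\<forall>\<^sub>F N in sequentially. hausdorff_premeasure s \<delta> S \<le> ennreal (n powr s * real N powr (n - s))"
    proof -
      have "(\<lambda>N. n / real N) \<longlonglongrightarrow> 0"
        by (intro tendsto_divide_0[OF tendsto_const] filterlim_at_top_imp_at_infinity filterlim_real_sequentially)
      then have "\<forall>\<^sub>F N in sequentially. n / real N < \<delta>" using that by (rule order_tendstoD)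
      then show ?thesis using eventually_gt_at_top[of 0]
        by eventually_elim (intro bound, auto)
    qed
    ultimately have "hausdorff_premeasure s \<delta> S \<le> ennreal 0"
      by (intro tendsto_lowerbound) auto
    then show ?thesis by simp
  qed
  then show ?thesis unfolding hausdorff_measure_def by (simp add: SUP_eq_iff)
qed

lemma hausdorff_dim_le_in_unit_cube:
  fixes S :: "(real^'n) set"
  assumes "S \<subseteq> cube 0 1"
  shows "hausdorff_dim S \<le> of_nat CARD('n)"
proof (rule ennreal_le_epsilon)
  fix e :: real assume "0 < e"
  then have "hausdorff_measure (real CARD('n) + e) S = 0"
    using assms by (intro hausdorff_measure_eq_0_above_dimension) auto
  then have "hausdorff_dim S \<le> ennreal (real CARD('n) + e)"
    unfolding hausdorff_dim_def using \<open>0 < e\<close> by (intro INF_lower) auto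
  then show "hausdorff_dim S \<le> of_nat CARD('n) + ennreal e"
    using \<open>0 < e\<close> by (simp add: ennreal_of_nat_eq_real_of_nat)
qed

section \<open>Points outside every cheap cover\<close>

lemma hausdorff_null_imp_small_cover:
  fixes S :: "'a::metric_space set"
  assumes "hausdorff_measure s S = 0" "0 < e"
  obtains U :: "nat \<Rightarrow> 'a set" where "S \<subseteq> (\<Union>i. U i)" "\<And>i. bounded (U i)" "\<And>i. diameter (U i) \<le> 1"
    "(\<Sum>i. hausdorff_gauge s (U i)) < ennreal e"
proof -
  have "hausdorff_premeasure s 1 S \<le> hausdorff_measure s S"
    unfolding hausdorff_measure_def by (intro SUP_upper) auto
  then have "hausdorff_premeasure s 1 S < ennreal e" using assms by simp
  then show thesis
    unfolding hausdorff_premeasure_def INF_less_iff using that by auto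
qed

text \<open>
  This replaces a cheap cover for the exponent \<open>s\<close>, which may be 0, by one for a positive exponent.
\<close>

lemma hausdorff_gauge_antimono:
  assumes "bounded U" "diameter U \<le> 1" "0 \<le> s" "s \<le> t" "0 < t"
  shows "hausdorff_gauge t U \<le> hausdorff_gauge s U"
proof -
  have d: "0 \<le> diameter U" using assms(1) by (rule diameter_ge_0)
  show ?thesis
  proof (cases "s = 0")
    case True
    have "diameter U powr t \<le> 1 powr t" using assms d by (intro powr_mono2) auto
    then show ?thesis using True assms by (simp add: hausdorff_gauge_def)
  next
    case False
    then show ?thesis using assms d
      by (auto simp: hausdorff_gauge_def intro!: ennreal_leI powr_mono')
  qed
qed

text \<open>
  A set of diameter below \<open>h\<close> reaches from one subcube of side \<open>h\<close> only into its neighbours.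
\<close>

lemma card_cubes_meeting_small_set:
  fixes a :: "real^'n"
  assumes U: "bounded U" "diameter U < h" and "0 < h"
  shows "card {v \<in> grid L. U \<inter> cube (corner a h v) h \<noteq> {}} \<le> 3 ^ CARD('n)"
proof (cases "{v \<in> grid L. U \<inter> cube (corner a h v) h \<noteq> {}} = {}")
  case False
  then obtain v where v: "U \<inter> cube (corner a h v) h \<noteq> {}" by auto
  then obtain x where x: "x \<in> U" "x \<in> cube (corner a h v) h" by auto
  define N where "N = (\<Pi>\<^sub>E i\<in>(UNIV::'n set). {v i - 1..v i + 1})"
  have "w \<in> N" if w: "U \<inter> cube (corner a h w) h \<noteq> {}" for w
  proof -
    obtain y where y: "y \<in> U" "y \<in> cube (corner a h w) h" using w by auto
    have "w i \<in> {v i - 1..v i + 1}" for i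
    proof -
      have "\<bar>(x - y) $ i\<bar> \<le> norm (x - y)" by (rule component_le_norm_cart)
      also have "\<dots> \<le> diameter U"
        using diameter_bounded_bound[OF U(1) x(1) y(1)] by (simp add: dist_norm)
      finally have "\<bar>x $ i - y $ i\<bar> < h" using U(2) by simp
      moreover have "a $ i + h * real (v i) \<le> x $ i \<and> x $ i \<le> a $ i + h * real (v i) + h"
        "a $ i + h * real (w i) \<le> y $ i \<and> y $ i \<le> a $ i + h * real (w i) + h"
        using x(2) y(2) by (auto simp: cube_def corner_def)
      ultimately have "\<bar>h * real (v i) - h * real (w i)\<bar> < h * 2" by linarith
      then have "h * \<bar>real (v i) - real (w i)\<bar> < h * 2"
        using \<open>0 < h\<close> by (simp add: abs_mult flip: right_diff_distrib)
      then have "\<bar>real (v i) - real (w i)\<bar> < 2" using \<open>0 < h\<close> by simp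
      then show ?thesis by auto
    qed
    then show ?thesis by (auto simp: N_def)
  qed
  then have "card {v \<in> grid L. U \<inter> cube (corner a h v) h \<noteq> {}} \<le> card N"
    by (intro card_mono) (auto simp: N_def intro!: finite_PiE)
  also have "\<dots> = (\<Prod>i\<in>UNIV. card {v i - 1..v i + 1})" by (simp add: N_def card_PiE)
  also have "\<dots> \<le> (\<Prod>i\<in>(UNIV::'n set). 3)" by (intro prod_mono) auto
  finally show ?thesis by simp
next
  case True
  then show ?thesis by (simp only: card.empty)
qed

text \<open>
  This is the mass distribution principle in the form of a greedy choice. The potential \<open>\<phi> k a\<close> is the
  total cost of the sets \<open>U i\<close> that meet the cube with corner \<open>a\<close> of side \<open>h k\<close>, and it is kept below
  \<open>h (k + 1) powr t\<close>. This bound forces every set that still meets the cube to have diameter below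
  \<open>h (k + 1)\<close>, so that it meets at most \<open>3 ^ n\<close> subcubes. The potentials of the subcubes therefore add up to
  at most \<open>3 ^ n\<close> times the old one. By \<open>sparse\<close> at least half of the subcubes avoid \<open>D k\<close>, and by \<open>room\<close>
  one of these has a potential smaller by the factor \<open>L powr t\<close>. A set that contains the limit point
  would contribute its fixed cost to all these potentials, which tend to 0.
\<close>

lemma ex_point_avoiding_small_cover:
  fixes D :: "nat \<Rightarrow> (real^'n) set" and U :: "nat \<Rightarrow> (real^'n) set"
  defines "n \<equiv> CARD('n)"
  assumes "0 < L" "0 < h0" "0 < t"
    and sparse: "\<And>k a. 2 * card {v \<in> grid L. cube (corner a (h0 / real L ^ Suc k) v) (h0 / real L ^ Suc k) \<inter> D k \<noteq> {}}
                    \<le> L ^ n"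
    and room: "2 * 3 ^ n * real L powr t \<le> real (L ^ n)"
    and U: "\<And>i. bounded (U i)" 
    and small: "(\<Sum>i. hausdorff_gauge t (U i)) < ennreal ((h0 / real L) powr t)"
  shows "\<exists>x \<in> cube 0 h0. x \<notin> (\<Union>k. D k) \<and> x \<notin> (\<Union>i. U i)"
proof -
  define h where "h k = h0 / real L ^ k" for k
  have h: "0 < h k" "h (Suc k) = h k / real L" "h 0 = h0" for k
    using assms by (auto simp: h_def)
  \<comment> \<open>Sets of diameter 0 have gauge 0 and would escape the potential, so all costs are made positive.\<close>
  obtain w :: "nat \<Rightarrow> ennreal" where w: "\<And>i. 0 < w i" "\<And>i. hausdorff_gauge t (U i) \<le> w i"
    "(\<Sum>i. w i) < ennreal (h 1 powr t)"
  proof -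
    obtain e :: real where e: "0 < e" "(\<Sum>i. hausdorff_gauge t (U i)) + ennreal e < ennreal (h 1 powr t)"
    proof -
      obtain c where c: "(\<Sum>i. hausdorff_gauge t (U i)) < c" "c < ennreal (h 1 powr t)"
        using small dense by (auto simp: h_def)
      obtain r where r: "(\<Sum>i. hausdorff_gauge t (U i)) = ennreal r" "0 \<le> r"
        using c by (cases "\<Sum>i. hausdorff_gauge t (U i)") auto
      have r': "r < h 1 powr t" using c r by (metis order_less_trans ennreal_less_iff)
      show thesis
      proof
        show "0 < (h 1 powr t - r) / 2" using r' by simp
        have "r + (h 1 powr t - r) / 2 < h 1 powr t" using r' by (simp add: field_simps)
        then have "ennreal (r + (h 1 powr t - r) / 2) < ennreal (h 1 powr t)"
          using r r' by (intro ennreal_lessI) auto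
        then show "(\<Sum>i. hausdorff_gauge t (U i)) + ennreal ((h 1 powr t - r) / 2) < ennreal (h 1 powr t)"
          using r r' by (simp add: ennreal_plus)
      qed
    qed
    show thesis
    proof
      show "0 < hausdorff_gauge t (U i) + ennreal (e * (1/2) ^ Suc i)" for i
        using e(1) by (simp add: add_nonneg_pos)
      show "hausdorff_gauge t (U i) \<le> hausdorff_gauge t (U i) + ennreal (e * (1/2) ^ Suc i)" for i
        by simp
      have "(\<lambda>i. e * (1/2) ^ Suc i) sums (e * 1)"
        by (intro sums_mult power_half_series)
      then have "(\<Sum>i. ennreal (e * (1/2) ^ Suc i)) = ennreal e"
        using e(1) by (intro suminf_ennreal_eq) auto
      then show "(\<Sum>i. hausdorff_gauge t (U i) + ennreal (e * (1/2) ^ Suc i)) < ennreal (h 1 powr t)"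
        using e(2) by (subst suminf_add[symmetric]) auto
    qed
  qed
  define meets :: "nat \<Rightarrow> nat \<Rightarrow> real^'n \<Rightarrow> ennreal"
    where "meets i k a = (if U i \<inter> cube a (h k) \<noteq> {} then 1 else 0)" for i k a
  define \<phi> where "\<phi> k a = (\<Sum>i. w i * meets i k a)" for k a
  have \<phi>_term: "w i \<le> \<phi> k a" if "U i \<inter> cube a (h k) \<noteq> {}" for i k a
  proof -
    have "w i * meets i k a \<le> (\<Sum>i. w i * meets i k a)"
      by (rule sum_le_suminf[of _ "{i}", simplified]) auto
    then show ?thesis using that by (simp add: \<phi>_def meets_def)
  qed
  have step: "\<exists>b. \<phi> (Suc k) b < ennreal (h (Suc (Suc k)) powr t) \<and>
                 cube b (h (Suc k)) \<subseteq> cube a (h k) \<and> cube b (h (Suc k)) \<inter> D k = {}"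
    if a: "\<phi> k a < ennreal (h (Suc k) powr t)" for k a
  proof -
    define sub where "sub v = cube (corner a (h (Suc k)) v) (h (Suc k))" for v
    define G where "G = {v \<in> grid L. sub v \<inter> D k = {}}"
    have sub: "sub v \<subseteq> cube a (h k)" if "v \<in> grid L" for v
      unfolding sub_def h(2) using that h(1)[of k] by (intro cube_corner_subset) auto
    have "card G + card {v \<in> grid L. sub v \<inter> D k \<noteq> {}} = L ^ n"
    proof -
      have eq: "grid L = G \<union> {v \<in> grid L. sub v \<inter> D k \<noteq> {}}" by (auto simp: G_def)
      show ?thesis unfolding n_def card_grid[symmetric]
        by (subst (2) eq, subst card_Un_disjoint) (auto simp: G_def)
    qed
    moreover have "2 * card {v \<in> grid L. sub v \<inter> D k \<noteq> {}} \<le> L ^ n"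
      using sparse[of a k] by (simp add: sub_def h_def)
    ultimately have G: "L ^ n \<le> 2 * card G" by linarith
    have finG: "finite G" unfolding G_def by simp
    have few: "(\<Sum>v\<in>G. meets i (Suc k) (corner a (h (Suc k)) v)) \<le> 3 ^ n * meets i k a" for i
    proof (cases "U i \<inter> cube a (h k) = {}")
      case True
      then have "meets i (Suc k) (corner a (h (Suc k)) v) = 0" if "v \<in> G" for v
        using sub[of v] that by (auto simp: meets_def G_def sub_def)
      then show ?thesis by simp
    next
      case False
      have "U i \<noteq> {}" using False by auto
      moreover have "hausdorff_gauge t (U i) < ennreal (h (Suc k) powr t)"
        using w(2)[of i] \<phi>_term[OF False] a by (meson order.trans order.strict_trans1)
      ultimately have "diameter (U i) powr t < h (Suc k) powr t"
        using \<open>0 < t\<close> by (simp add: hausdorff_gauge_def ennreal_less_iff)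
      then have diam: "diameter (U i) < h (Suc k)"
        using \<open>0 < t\<close> powr_mono2[of t "h (Suc k)" "diameter (U i)"] h(1)[of "Suc k"]
        by (smt (verit))
      have "(\<Sum>v\<in>G. meets i (Suc k) (corner a (h (Suc k)) v))
          = of_nat (card {v \<in> G. U i \<inter> sub v \<noteq> {}})"
        using finG by (simp add: meets_def sub_def sum.If_cases Int_def)
      also have "card {v \<in> G. U i \<inter> sub v \<noteq> {}} \<le> card {v \<in> grid L. U i \<inter> sub v \<noteq> {}}"
        by (intro card_mono) (auto simp: G_def)
      also have "\<dots> \<le> 3 ^ n"
        unfolding sub_def n_def using U diam h(1) by (intro card_cubes_meeting_small_set)
      finally show ?thesis using False by (simp add: meets_def)
    qed
    have "\<exists>v\<in>G. \<phi> (Suc k) (corner a (h (Suc k)) v) < ennreal (h (Suc (Suc k)) powr t)"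
    proof (rule ccontr)
      assume "\<not> ?thesis"
      then have big: "ennreal (h (Suc (Suc k)) powr t) \<le> \<phi> (Suc k) (corner a (h (Suc k)) v)" if "v \<in> G" for v
        using that by (auto simp: not_less)
      have three: "(3::ennreal) ^ n = ennreal (3 ^ n)" by (simp flip: ennreal_power)
      have "ennreal (3 ^ n * h (Suc k) powr t) \<le> ennreal (real (card G) * h (Suc (Suc k)) powr t)"
      proof (rule ennreal_leI)
        have eq: "h (Suc (Suc k)) powr t = h (Suc k) powr t / real L powr t"
          unfolding h(2)[of "Suc k"] using h(1) by (simp add: powr_divide)
        have "3 ^ n * real L powr t \<le> real (card G)"
        proof -
          have "real (L ^ n) \<le> real (2 * card G)" using G by (rule of_nat_mono)
          then show ?thesis using room by simp
        qed
        then have "3 ^ n * real L powr t * h (Suc k) powr t \<le> real (card G) * h (Suc k) powr t"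
          by (intro mult_right_mono) auto
        then show "3 ^ n * h (Suc k) powr t \<le> real (card G) * h (Suc (Suc k)) powr t"
          using \<open>0 < L\<close> by (simp add: eq pos_le_divide_eq mult_ac)
      qed
      also have "\<dots> = (\<Sum>v\<in>G. ennreal (h (Suc (Suc k)) powr t))"
        by (simp add: ennreal_mult ennreal_of_nat_eq_real_of_nat)
      also have "\<dots> \<le> (\<Sum>v\<in>G. \<phi> (Suc k) (corner a (h (Suc k)) v))"
        using big by (intro sum_mono)
      also have "\<dots> = (\<Sum>i. \<Sum>v\<in>G. w i * meets i (Suc k) (corner a (h (Suc k)) v))"
        unfolding \<phi>_def by (intro suminf_sum[symmetric]) auto
      also have "\<dots> \<le> (\<Sum>i. 3 ^ n * (w i * meets i k a))"
      proof (intro suminf_le)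
        fix i
        have "(\<Sum>v\<in>G. w i * meets i (Suc k) (corner a (h (Suc k)) v))
            \<le> w i * (3 ^ n * meets i k a)"
          unfolding sum_distrib_left[symmetric] using few by (intro mult_left_mono) auto
        then show "(\<Sum>v\<in>G. w i * meets i (Suc k) (corner a (h (Suc k)) v)) \<le> 3 ^ n * (w i * meets i k a)"
          by (simp add: mult_ac)
      qed auto
      also have "\<dots> = 3 ^ n * \<phi> k a" unfolding \<phi>_def by simp
      also have "\<dots> < 3 ^ n * ennreal (h (Suc k) powr t)"
        using a by (intro ennreal_mult_strict_left_mono) (auto simp: three)
      also have "\<dots> = ennreal (3 ^ n * h (Suc k) powr t)"
        by (simp add: three ennreal_mult)
      finally show False by simp
    qed
    then obtain v where v: "v \<in> G" "\<phi> (Suc k) (corner a (h (Suc k)) v) < ennreal (h (Suc (Suc k)) powr t)"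
      by blast
    then show ?thesis using sub[of v] by (intro exI[of _ "corner a (h (Suc k)) v"]) (auto simp: G_def sub_def)
  qed
  have "\<phi> 0 0 \<le> (\<Sum>i. w i)"
    unfolding \<phi>_def by (intro suminf_le) (auto simp: meets_def)
  then have "\<phi> 0 0 < ennreal (h (Suc 0) powr t)" using w(3) by simp
  then obtain b where b: "b 0 = 0" "\<And>k. \<phi> k (b k) < ennreal (h (Suc k) powr t)"
    "\<And>k. cube (b (Suc k)) (h (Suc k)) \<subseteq> cube (b k) (h k)"
    "\<And>k. cube (b (Suc k)) (h (Suc k)) \<inter> D k = {}"
  proof -
    have "\<exists>b. \<forall>k. (\<phi> k (b k) < ennreal (h (Suc k) powr t) \<and> (k = 0 \<longrightarrow> b k = 0)) \<and>
            (cube (b (Suc k)) (h (Suc k)) \<subseteq> cube (b k) (h k) \<and> cube (b (Suc k)) (h (Suc k)) \<inter> D k = {})"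
    proof (rule dependent_nat_choice)
      show "\<exists>x. \<phi> 0 x < ennreal (h (Suc 0) powr t) \<and> (0 = (0::nat) \<longrightarrow> x = 0)"
        using \<open>\<phi> 0 0 < _\<close> by blast
    qed (use step in auto)
    then show thesis using that by blast
  qed
  have "\<Inter> (range (\<lambda>k. cube (b k) (h k))) \<noteq> {}"
  proof (rule compact_nest)
    show "cube (b k) (h k) \<noteq> {}" for k
      using base_mem_cube[of "h k" "b k"] h(1)[of k] by auto
    show "k \<le> l \<Longrightarrow> cube (b l) (h l) \<subseteq> cube (b k) (h k)" for k l
      by (rule lift_Suc_antimono_le[of "\<lambda>k. cube (b k) (h k)"]) (use b(3) in auto)
  qed (rule compact_cube)
  then obtain x where x: "\<And>k. x \<in> cube (b k) (h k)" by auto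
  have "x \<notin> U i" for i
  proof
    assume "x \<in> U i"
    then have le: "w i \<le> ennreal (h (Suc k) powr t)" for k
    proof -
      have "U i \<inter> cube (b k) (h k) \<noteq> {}" using \<open>x \<in> U i\<close> x[of k] by auto
      then have "w i \<le> \<phi> k (b k)" by (rule \<phi>_term)
      also note b(2)[of k]
      finally show ?thesis by (rule less_imp_le)
    qed
    have "(\<lambda>k. h (Suc k) powr t) \<longlonglongrightarrow> 0 powr t"
    proof (intro tendsto_powr2)
      have "2 \<le> L"
      proof (rule ccontr)
        assume "\<not> 2 \<le> L"
        then have "L = 1" using \<open>0 < L\<close> by simp
        then have "2 * 3 ^ n \<le> (1::real)" using room by simp
        moreover have "1 \<le> (3::real) ^ n" by simp
        ultimately show False by linarith
      qed
      then have "(\<lambda>k. h0 * (1 / real L) ^ k) \<longlonglongrightarrow> 0"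
        by (intro tendsto_mult_right_zero LIMSEQ_power_zero) auto
      then have "h \<longlonglongrightarrow> 0" by (simp add: h_def[abs_def] power_one_over divide_inverse power_inverse)
      then show "(\<lambda>k. h (Suc k)) \<longlonglongrightarrow> 0" by (rule LIMSEQ_Suc)
    qed (use h(1) \<open>0 < t\<close> in \<open>auto intro: less_imp_le always_eventually\<close>)
    then have "(\<lambda>k. ennreal (h (Suc k) powr t)) \<longlonglongrightarrow> ennreal 0"
      by (intro tendsto_ennrealI) simp
    then have "w i \<le> ennreal 0"
      using le by (intro LIMSEQ_le_const) auto
    then show False using w(1)[of i] by simp
  qed
  moreover have "x \<notin> D k" for k using x[of "Suc k"] b(4)[of k] by auto
  moreover have "x \<in> cube 0 h0" using x[of 0] b(1) h(3) by simp
  ultimately show ?thesis by auto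
qed

section \<open>Badly approximable targets\<close>

lemma ex_power_bracket:
  assumes "1 \<le> z" "z < (b::real) ^ N"
  shows "\<exists>i<N. b ^ i \<le> z \<and> z < b ^ Suc i"
  using assms(2)
proof (induction N)
  case (Suc N)
  then show ?case by (cases "z < b ^ N") (auto intro: less_SucI)
qed (use assms(1) in simp)

text \<open>
  With \<open>L = 2 ^ T\<close>, the first inequality lets a number of slabs proportional to \<open>log L\<close> leave half of the
  subcubes untouched; the second one leaves room for the exponent \<open>t = n - r\<close>.
\<close>

lemma ex_power_2_dominating:
  fixes C D r :: real
  assumes "0 < r"
  shows "\<exists>T\<ge>1. C * real T \<le> 2 ^ T \<and> D \<le> (2 ^ T) powr r"
proof -
  have "(\<lambda>T. \<bar>C\<bar> * (real T * (1/2) ^ T)) \<longlonglongrightarrow> 0"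
    using powser_times_n_limit_0[of "1/2::real"] by (intro tendsto_mult_right_zero) simp
  then have "\<forall>\<^sub>F T in sequentially. \<bar>C\<bar> * (real T * (1/2) ^ T) < 1"
    by (rule order_tendstoD) simp
  moreover have "\<forall>\<^sub>F T in sequentially. D \<le> (2 powr r) ^ T"
  proof -
    obtain N where N: "D < (2 powr r) ^ N"
      using real_arch_pow[of "2 powr r"] assms by auto
    have "D \<le> (2 powr r) ^ T" if "N \<le> T" for T
      using N power_increasing[OF that, of "2 powr r"] assms ge_one_powr_ge_zero[of 2 r] by linarith
    then show ?thesis unfolding eventually_sequentially by blast
  qed
  ultimately have "\<forall>\<^sub>F T in sequentially. C * real T \<le> 2 ^ T \<and> D \<le> (2 ^ T) powr r"
  proof eventually_elim
    case (elim T)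
    have "\<bar>C\<bar> * real T < 2 ^ T" using elim(1) by (simp add: power_one_over field_simps)
    then have "C * real T \<le> 2 ^ T"
      by (smt (verit) mult_right_mono of_nat_0_le_iff)
    moreover have "(2 powr r) ^ T = (2 ^ T) powr r"
      by (simp add: powr_powr mult.commute flip: powr_realpow)
    ultimately show ?case using elim(2) by simp
  qed
  then obtain N where "\<forall>T\<ge>N. C * real T \<le> 2 ^ T \<and> D \<le> (2 ^ T) powr r"
    by (auto simp: eventually_sequentially)
  then show ?thesis by (intro exI[of _ "max N 1"]) auto
qed

lemma card_shortest_dual_approx_between:
  fixes A :: "real^'m^'n" and T :: nat
  assumes "0 < R"
  defines "Y \<equiv> {y \<in> range (shortest_dual_approx A). R \<le> infnorm y \<and> infnorm y < 2 ^ T * R}"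
  shows "finite Y" "card Y \<le> T * (4 ^ CARD('n) + 1)"
proof -
  define Z where "Z i = {y \<in> range (shortest_dual_approx A).
                      2 ^ i * R \<le> infnorm y \<and> infnorm y < 2 * (2 ^ i * R)}" for i
  have Z: "finite (Z i)" "card (Z i) \<le> 4 ^ CARD('n) + 1" for i
    unfolding Z_def using \<open>0 < R\<close> by (intro card_shortest_dual_approx_dyadic; simp)+
  have "Y \<subseteq> (\<Union>i<T. Z i)"
  proof
    fix y assume y: "y \<in> Y"
    then have "1 \<le> infnorm y / R" "infnorm y / R < 2 ^ T"
      using \<open>0 < R\<close> by (auto simp: Y_def field_simps)
    then obtain i where "i < T" "2 ^ i \<le> infnorm y / R" "infnorm y / R < 2 ^ Suc i"
      using ex_power_bracket by blast
    then have "y \<in> Z i" using y \<open>0 < R\<close> by (simp add: Z_def Y_def field_simps)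
    then show "y \<in> (\<Union>i<T. Z i)" using \<open>i < T\<close> by blast
  qed
  moreover have fin: "finite (\<Union>i<T. Z i)" using Z by blast
  ultimately show "finite Y" by (rule finite_subset)
  have "card Y \<le> card (\<Union>i<T. Z i)" using fin \<open>Y \<subseteq> _\<close> by (intro card_mono)
  also have "\<dots> \<le> (\<Sum>i<T. card (Z i))" by (rule card_UN_le) simp
  also have "\<dots> \<le> (\<Sum>i<T. 4 ^ CARD('n) + 1)" by (intro sum_mono Z)
  finally show "card Y \<le> T * (4 ^ CARD('n) + 1)" by simp
qed

text \<open>
  Level \<open>k\<close> consists of cubes of side \<open>h k = L powi (- k - 1)\<close> and removes the slabs of those dual
  approximations \<open>y\<close> for which \<open>2 * n * |y|\<close> has the order \<open>L ^ k\<close>, so that \<open>y \<bullet> x\<close> varies by at most \<open>1/2\<close>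
  over a cube. Every \<open>y\<close> is treated at exactly one level. The initial side \<open>1 / L\<close> also
  keeps the coordinates of the limit point below 1.
\<close>

lemma hausdorff_measure_Bad_below_dimension:
  fixes A :: "real^'m^'n"
  assumes s: "0 \<le> s" "s < real CARD('n)"
  shows "hausdorff_measure s (Bad A) \<noteq> 0"
proof
  assume null: "hausdorff_measure s (Bad A) = 0"
  define n where "n = CARD('n)"
  define K where "K = 4 ^ n + (1::nat)"
  \<comment> \<open>An exponent strictly above \<open>s\<close> is positive even if \<open>s = 0\<close>.\<close>
  define t where "t = (s + real n) / 2"
  have t: "0 < t" "s < t" "t < real n" using s by (auto simp: t_def n_def)
  have n: "1 \<le> n" by (simp add: n_def Suc_leI)
  obtain T where T: "1 \<le> T" "real (2 * K * (2 * n + 2)) * real T \<le> 2 ^ T"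
    "2 * 3 ^ n \<le> (2 ^ T) powr (real n - t)"
    using ex_power_2_dominating[of "real n - t" "real (2 * K * (2 * n + 2))" "2 * 3 ^ n"] t by auto
  define L where "L = (2::nat) ^ T"
  have L: "2 \<le> L" "real L = 2 ^ T"
    using T(1) self_le_power[of "2::nat" T] by (auto simp: L_def)
  \<comment> \<open>The slabs may be at most as thick as one subcube of the level at which they are removed: \<open>2 * c * L \<le> |y| * h k\<close>.\<close>
  define c where "c = 1 / (4 * real n * real L ^ 2)"
  define h where "h k = 1 / real L / real L ^ k" for k
  define Y where "Y k = {y \<in> range (shortest_dual_approx A).
      real L ^ k \<le> 2 * real n * infnorm y \<and> 2 * real n * infnorm y < real L ^ Suc k}" for k
  define D where "D k = {x. \<exists>y\<in>Y k. \<exists>p\<in>\<int>. \<bar>y \<bullet> x - p\<bar> < c}" for k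
  have "0 < c" using n L by (simp add: c_def)
  have Y: "finite (Y k)" "card (Y k) \<le> T * K" for k
  proof -
    have "Y k = {y \<in> range (shortest_dual_approx A). real L ^ k / (2 * real n) \<le> infnorm y \<and>
                    infnorm y < 2 ^ T * (real L ^ k / (2 * real n))}"
      using n by (auto simp: Y_def L(2) field_simps)
    moreover have "0 < real L ^ k / (2 * real n)" using n L by simp
    ultimately show "finite (Y k)" "card (Y k) \<le> T * K"
      using card_shortest_dual_approx_between[of "real L ^ k / (2 * real n)" A T]
      by (simp_all only: K_def n_def)
  qed
  have sparse: "2 * card {v \<in> grid L. cube (corner a (h (Suc k)) v) (h (Suc k)) \<inter> D k \<noteq> {}} \<le> L ^ n"
    (is "2 * card ?B \<le> _") for k and a :: "real^'n"
  proof -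
    define S where "S y = {v \<in> grid L. \<exists>x \<in> cube (corner a (h (Suc k)) v) (h (Suc k)).
                  \<exists>p\<in>\<int>. \<bar>y \<bullet> x - p\<bar> < c}" for y
    have S: "card (S y) * L \<le> (2 * n + 2) * L ^ n" if y: "y \<in> Y k" for y
    proof -
      have hL: "h (Suc k) = h k / real L" by (simp add: h_def)
      have yk: "real L ^ k \<le> 2 * real n * infnorm y" "2 * real n * infnorm y < real L * real L ^ k"
        using y by (auto simp: Y_def)
      show ?thesis unfolding S_def hL n_def
      proof (rule card_cubes_meeting_slab)
        have "0 < real L ^ k" using L(1) by simp
        then show "y \<noteq> 0" using yk(1) infnorm_0 by (metis mult_zero_right not_le)
        show "0 < L" "0 < h k" using L by (auto simp: h_def)
        have "1 * 1 \<le> real n * real L ^ 2" using n L by (intro mult_mono) auto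
        then show "c \<le> 1 / 4" using n L by (simp add: c_def field_simps)
        show "2 * real CARD('n) * infnorm y * h k \<le> 1"
          using yk(2) L by (simp add: h_def n_def field_simps)
        have "2 * c * real L = real L ^ k / (2 * real n) * h k"
          using L n by (simp add: c_def h_def field_simps power2_eq_square)
        also have "\<dots> \<le> infnorm y * h k"
          using yk(1) n by (intro mult_right_mono) (auto simp: h_def field_simps)
        finally show "2 * c * real L \<le> infnorm y * h k" .
      qed
    qed
    have "?B \<subseteq> (\<Union>y\<in>Y k. S y)" by (auto simp: D_def S_def)
    moreover have "finite (\<Union>y\<in>Y k. S y)" using Y(1) by (auto simp: S_def)
    ultimately have "card ?B \<le> card (\<Union>y\<in>Y k. S y)" by (intro card_mono)
    also have "\<dots> \<le> (\<Sum>y\<in>Y k. card (S y))" by (rule card_UN_le[OF Y(1)])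
    finally have "card ?B * L \<le> (\<Sum>y\<in>Y k. card (S y) * L)"
      by (simp flip: sum_distrib_right)
    also have "\<dots> \<le> (\<Sum>y\<in>Y k. (2 * n + 2) * L ^ n)" using S by (intro sum_mono)
    also have "\<dots> = card (Y k) * ((2 * n + 2) * L ^ n)" by simp
    also have "\<dots> \<le> (T * K) * ((2 * n + 2) * L ^ n)" using Y(2) by (rule mult_right_mono) simp
    finally have "(2 * card ?B) * L \<le> (2 * K * (2 * n + 2) * T) * L ^ n" by (simp add: algebra_simps)
    also have "\<dots> \<le> L * L ^ n"
    proof (rule mult_right_mono)
      have "real (2 * K * (2 * n + 2) * T) \<le> real L" using T(2) L(2) by simp
      then show "2 * K * (2 * n + 2) * T \<le> L" by (simp only: of_nat_le_iff)
    qed simp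
    finally show ?thesis using L(1) by (simp add: mult.commute)
  qed
  have room: "2 * 3 ^ n * real L powr t \<le> real (L ^ n)"
  proof -
    have "2 * 3 ^ n * real L powr t \<le> real L powr (real n - t) * real L powr t"
      using T(3) L(2) by (intro mult_right_mono) auto
    also have "\<dots> = real L powr real n" by (simp flip: powr_add)
    finally show ?thesis using L(1) by (simp add: powr_realpow)
  qed
  obtain U where U: "Bad A \<subseteq> (\<Union>i. U i)" "\<And>i. bounded (U i)" "\<And>i. diameter (U i) \<le> 1"
    "(\<Sum>i. hausdorff_gauge s (U i)) < ennreal ((1 / real L / real L) powr t)"
    using hausdorff_null_imp_small_cover[OF null, of "(1 / real L / real L) powr t"] L(1) by auto
  have "(\<Sum>i. hausdorff_gauge t (U i)) \<le> (\<Sum>i. hausdorff_gauge s (U i))"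
    using U s t by (intro suminf_le hausdorff_gauge_antimono) auto
  then have small: "(\<Sum>i. hausdorff_gauge t (U i)) < ennreal ((1 / real L / real L) powr t)"
    using U(4) by (rule order_le_less_trans)
  have "\<exists>x \<in> cube 0 (1 / real L). x \<notin> (\<Union>k. D k) \<and> x \<notin> (\<Union>i. U i)"
    using sparse room L(1) t(1) unfolding h_def n_def
    by (intro ex_point_avoiding_small_cover[OF _ _ _ _ _ U(2) small]) auto
  then obtain x where x: "x \<in> cube 0 (1 / real L)" "\<And>k. x \<notin> D k" "x \<notin> (\<Union>i. U i)" by auto
  have "x \<in> Bad A"
  proof (rule Bad_if_bad_for_dual_approx)
    show "0 \<le> x $ i \<and> x $ i < 1" for i
    proof -
      have "0 \<le> x $ i" "x $ i \<le> 1 / real L" using x(1) by (auto simp: cube_def)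
      moreover have "1 / real L < 1" using L(1) by simp
      ultimately show ?thesis by linarith
    qed
    show "0 < c" by fact
    fix j p assume "p \<in> (\<int> :: real set)"
    define y where "y = shortest_dual_approx A j"
    have "1 \<le> infnorm y"
      using shortest_dual_approx(1)[of A j] infnorm_int_vectors_ge_1
      by (auto simp: y_def dual_approx_def)
    then have "1 * 1 \<le> (2 * real n) * infnorm y" using n by (intro mult_mono) auto
    moreover obtain N where "2 * real n * infnorm y < real L ^ N"
      using real_arch_pow[of "real L"] L(1) by auto
    ultimately obtain k where "real L ^ k \<le> 2 * real n * infnorm y"
      "2 * real n * infnorm y < real L ^ Suc k"
      using ex_power_bracket[of "2 * real n * infnorm y" "real L" N] by auto
    then have "y \<in> Y k" by (auto simp: Y_def y_def)
    then show "c \<le> \<bar>y \<bullet> x - p\<bar>" using x(2)[of k] \<open>p \<in> \<int>\<close> by (force simp: D_def not_less)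
  qed
  then show False using U(1) x(3) by blast
qed

theorem theorem1:
  fixes A :: "real ^ 'm ^ 'n"
  shows "hausdorff_dim (Bad A) = of_nat CARD('n)"
proof (rule antisym)
  show "hausdorff_dim (Bad A) \<le> of_nat CARD('n)"
    by (rule hausdorff_dim_le_in_unit_cube) (auto simp: Bad_def cube_def less_imp_le)
  show "of_nat CARD('n) \<le> hausdorff_dim (Bad A)"
    unfolding hausdorff_dim_def
  proof (rule INF_greatest)
    fix s assume "s \<in> {s. 0 \<le> s \<and> hausdorff_measure s (Bad A) = 0}"
    then have "real CARD('n) \<le> s"
      using hausdorff_measure_Bad_below_dimension[of s A] by (auto simp: not_le[symmetric])
    then show "of_nat CARD('n) \<le> ennreal s"
      by (simp add: ennreal_of_nat_eq_real_of_nat ennreal_leI)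
  qed
qed

end
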